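(* Let $n\ge 1$ be an integer, let $0<\lambda\le n$, and let $Q$ be a probability distribution on $\mathbb{N}=\{1,2,\ldots\}$. Suppose that $Q$ and the compound binomial distribution $\mathrm{CBin}(n,\lambda/n,Q)$ are both log-concave. Suppose also that $Q$ satisfies at least one of the following: (a) $Q$ has finite support; or (b) there exist $\rho,\beta>0$ and $N_0\ge 1$ such that $Q(x)\ge \rho^{x^\beta}$ for all integers $x\ge N_0$. Then $$H(\mathrm{CBin}(n,\lambda/n,Q))=\max\big\{H(C_Q b_{\mathbf p})\;:\;\mathbf p\in\mathcal P_n(\lambda)\big\}.$$
   Context: All distributions are probability mass functions on $\mathbb{Z}_+=\{0,1,2,\ldots\}$; a distribution on $\mathbb{N}=\{1,2,\ldots\}$ is regarded as a distribution on $\mathbb{Z}_+$ with mass $0$ at $0$. $H(P)=-\sum_x P(x)\log P(x)$ is the discrete entropy (natural logarithm, $0\log 0=0$). A distribution $P$ on $\mathbb{Z}_+$ is log-concave if its support is a (possibly infinite) interval of successive integers and $P(x)^2\ge P(x+1)P(x-1)$ for all $x\ge 1$. For a distribution $P$ on $\mathbb{Z}_+$ and a distribution $Q$ on $\mathbb{N}$, the $Q$-compound distribution is $C_QP(x)=\sum_{y=0}^\infty P(y)Q^{*y}(x)$, $x\ge 0$, where $Q^{*y}$ is the $y$-th convolution power of $Q$ and $Q^{*0}$ is the point mass at $0$; equivalently, it is the law of $\sum_{j=1}^Y X_j$ with $Y\sim P$ and $X_j$ i.i.d. $\sim Q$ independent of $Y$. For $\mathbf p=(p_1,\ldots,p_n)\in[0,1]^n$,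 $b_{\mathbf p}$ is the probability mass function of $\sum_{i=1}^n B_i$ with $B_i\sim\mathrm{Bern}(p_i)$ independent. $\mathcal P_n(\lambda)=\{\mathbf p\in[0,1]^n: p_1+\cdots+p_n=\lambda\}$. $\mathrm{CBin}(n,p,Q)$ is $C_Qb_{\mathbf p}$ with $\mathbf p=(p,\ldots,p)\in[0,1]^n$. *)

theory Defs
  imports "HOL-Probability.Probability"
begin

text \<open>
  Distributions on the nonnegative integers are elements of \<^typ>\<open>nat pmf\<close>; a distribution on
  the positive integers is one with mass 0 at 0.
\<close>

text \<open>
  Entropy takes values in the extended nonnegative reals, so that a divergent series has
  entropy \<open>\<infinity>\<close>. The coercion \<^const>\<open>ennreal\<close> truncates nothing (see the lemma below), and the
  convention \<open>0 log 0 = 0\<close> holds automatically.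
\<close>

definition pmf_entropy :: "nat pmf \<Rightarrow> ennreal" where
  "pmf_entropy P = (\<Sum>x. ennreal (- (pmf P x * ln (pmf P x))))"

lemma pmf_entropy_term_nonneg: "0 \<le> - (pmf P x * ln (pmf P x))"
proof (cases "pmf P x = 0")
  case False
  then have "ln (pmf P x) \<le> 0"
    using pmf_nonneg[of P x] pmf_le_1[of P x] by (simp add: order_less_le)
  then show ?thesis
    using pmf_nonneg[of P x] by (simp add: mult_nonneg_nonpos)
qed simp

definition log_concave_pmf :: "nat pmf \<Rightarrow> bool" where
  "log_concave_pmf P \<longleftrightarrow>
     (\<forall>x y z. x \<in> set_pmf P \<and> z \<in> set_pmf P \<and> x \<le> y \<and> y \<le> z \<longrightarrow> y \<in> set_pmf P) \<and>
     (\<forall>x\<ge>1. (pmf P x)\<^sup>2 \<ge> pmf P (x + 1) * pmf P (x - 1))"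

primrec conv_power :: "nat pmf \<Rightarrow> nat \<Rightarrow> nat pmf" where
  "conv_power Q 0 = return_pmf 0"
| "conv_power Q (Suc y) = map_pmf (\<lambda>(a, b). a + b) (pair_pmf Q (conv_power Q y))"

definition compound :: "nat pmf \<Rightarrow> nat pmf \<Rightarrow> nat pmf" where
  "compound Q P = bind_pmf P (conv_power Q)"

lemma pmf_compound: "pmf (compound Q P) x = (\<Sum>y. pmf P y * pmf (conv_power Q y) x)"
proof -
  have *: "integrable (count_space UNIV) (\<lambda>y. pmf P y * pmf (conv_power Q y) x)"
    by (rule Bochner_Integration.integrable_bound[OF integrable_pmf[of UNIV P]])
       (auto simp: pmf_le_1 mult_left_le)
  have "pmf (compound Q P) x = (\<integral>y. pmf P y * pmf (conv_power Q y) x \<partial>count_space UNIV)"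
    unfolding compound_def pmf_bind
    by (subst measure_pmf_eq_density) (simp add: integral_density)
  also have "\<dots> = (\<Sum>y. pmf P y * pmf (conv_power Q y) x)"
    using * by (rule integral_count_space_nat)
  finally show ?thesis .
qed

definition bernoulli_sum :: "nat \<Rightarrow> (nat \<Rightarrow> real) \<Rightarrow> nat pmf" where
  "bernoulli_sum n p =
     map_pmf (\<lambda>B. \<Sum>i=1..n. of_bool (B i)) (Pi_pmf {1..n} False (\<lambda>i. bernoulli_pmf (p i)))"

text \<open>
  A vector in \<open>[0,1]\<^sup>n\<close> is an extensional function on \<open>{1..n}\<close>, that is, one with the value
  \<^const>\<open>undefined\<close> outside \<open>{1..n}\<close>.
\<close>

definition param_set :: "nat \<Rightarrow> real \<Rightarrow> (nat \<Rightarrow> real) set" where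
  "param_set n l = {p \<in> {1..n} \<rightarrow>\<^sub>E {0..1}. (\<Sum>i=1..n. p i) = l}"

definition compound_binomial :: "nat \<Rightarrow> real \<Rightarrow> nat pmf \<Rightarrow> nat pmf" where
  "compound_binomial n p Q = compound Q (bernoulli_sum n (\<lambda>i\<in>{1..n}. p))"

end

theory Submission
  imports Defs
begin

text \<open>
  Put \<open>f = - ln g\<close>, where \<open>g\<close> is the compound binomial distribution. Since \<open>g\<close> is log-concave,
  \<open>f\<close> is convex (with the value \<open>\<infinity>\<close> off the support of \<open>g\<close>), and hence so is
  \<open>\<phi> y = E f (X\<^sub>1 + \<dots> + X\<^sub>y)\<close>. Replacing two parameters \<open>p\<^sub>i\<close>, \<open>p\<^sub>j\<close> on opposite sides of the mean
  by the mean and \<open>p\<^sub>i + p\<^sub>j\<close> minus the mean increases the expectation of the convex function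
  \<open>\<phi>\<close> under the Bernoulli sum, so the equal parameters maximise it. With Gibbs' inequality,
  \<open>H (C\<^sub>Q b\<^sub>p) \<le> E f\<close> under \<open>C\<^sub>Q b\<^sub>p\<close>, which is at most \<open>E f = H g\<close> under \<open>g\<close>. All expectations are
  taken in \<open>[0, \<infinity>]\<close>, so integrability plays no role.
\<close>

section \<open>Self-information and Gibbs' inequality\<close>

text \<open>The value \<open>\<infinity>\<close> off the support makes convexity hold on all
  naturals when \<open>P\<close> is log-concave. Since \<open>0 * \<infinity> = 0\<close> in
  \<open>ennreal\<close>, these points add nothing to an expectation under \<open>P\<close>
  itself.\<close>

definition self_information :: "nat pmf \<Rightarrow> nat \<Rightarrow> ennreal" where
  "self_information P x = (if pmf P x = 0 then \<infinity> else ennreal (- ln (pmf P x)))"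

lemma pmf_entropy_eq_nn_integral:
  "pmf_entropy P = (\<integral>\<^sup>+x. self_information P x \<partial>measure_pmf P)"
proof -
  have "ennreal (- (pmf P x * ln (pmf P x))) = ennreal (pmf P x) * self_information P x" for x
    unfolding self_information_def
    by (subst mult_minus_right[symmetric], subst ennreal_mult') simp_all
  then show ?thesis
    by (simp add: pmf_entropy_def nn_integral_measure_pmf nn_integral_count_space_nat)
qed

text \<open>Termwise this is \<open>ln t \<le> t - 1\<close> at the ratio of \<open>R\<close> to
  \<open>P\<close>. The masses of \<open>P\<close> and \<open>R\<close> are added to the two sides
  so that every term stays nonnegative; each has total 1, which cancels at the end.\<close>

lemma gibbs_inequality:
  "pmf_entropy P \<le> (\<integral>\<^sup>+x. self_information R x \<partial>measure_pmf P)"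
proof -
  have total: "(\<Sum>x. ennreal (pmf S x)) = 1" for S :: "nat pmf"
    using nn_integral_pmf[of UNIV S] by (simp add: nn_integral_count_space_nat)
  have term_le: "ennreal (- (pmf P x * ln (pmf P x))) + ennreal (pmf P x)
      \<le> ennreal (pmf P x) * self_information R x + ennreal (pmf R x)" for x
  proof (cases "pmf P x = 0 \<or> pmf R x = 0")
    \<comment> \<open>Either \<open>pmf P x = 0\<close> and the left side vanishes, or only
      \<open>pmf R x = 0\<close> and the right side is infinite.\<close>
    case True
    then show ?thesis
      by (auto simp: self_information_def ennreal_mult_top)
  next
    case False
    define a b where "a = pmf P x" and "b = pmf R x"
    have ab: "0 < a" "0 < b" "a \<le> 1" "b \<le> 1"
      using False by (simp_all add: a_def b_def order_less_le pmf_le_1)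
    have "ln b - ln a \<le> b / a - 1"
      using ln_le_minus_one[of "b / a"] ab by (simp add: ln_div)
    then have "a * (ln b - ln a) \<le> b - a"
      using mult_left_mono[of "ln b - ln a" "b / a - 1" a] ab by (simp add: field_simps)
    then have "- (a * ln a) + a \<le> a * (- ln b) + b"
      by (simp add: algebra_simps)
    moreover have "0 \<le> - (a * ln a)" "0 \<le> a * (- ln b)"
      using ab by (simp_all add: mult_nonneg_nonpos)
    ultimately have "ennreal (- (a * ln a)) + ennreal a \<le> ennreal a * ennreal (- ln b) + ennreal b"
      using ab by (simp flip: ennreal_plus ennreal_mult')
    then show ?thesis
      using False by (simp add: self_information_def a_def b_def)
  qed
  have "pmf_entropy P + 1 = (\<Sum>x. ennreal (- (pmf P x * ln (pmf P x))) + ennreal (pmf P x))"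
    by (simp add: pmf_entropy_def total suminf_add[symmetric])
  also have "\<dots> \<le> (\<Sum>x. ennreal (pmf P x) * self_information R x + ennreal (pmf R x))"
    by (intro suminf_le term_le) simp_all
  also have "\<dots> = (\<integral>\<^sup>+x. self_information R x \<partial>measure_pmf P) + 1"
    by (simp add: total suminf_add[symmetric] nn_integral_measure_pmf nn_integral_count_space_nat)
  finally show ?thesis
    by (simp add: ennreal_add_left_cancel_le add.commute[of _ 1])
qed

section \<open>From log-concavity to convexity of the self-information\<close>

lemma log_concave_pmf_support:
  "log_concave_pmf P \<Longrightarrow> pmf P x \<noteq> 0 \<Longrightarrow> pmf P z \<noteq> 0 \<Longrightarrow> x \<le> y \<Longrightarrow> y \<le> z \<Longrightarrow> 0 < pmf P y"
  unfolding log_concave_pmf_def set_pmf_iff by (metis pmf_nonneg order_less_le)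

text \<open>The ratios of successive masses decrease, here with denominators cleared. Each induction
  step multiplies the local inequality by the induction hypothesis and cancels a mass that is
  positive because the support is an interval.\<close>

lemma log_concave_pmf_four_point_Suc:
  assumes "log_concave_pmf P"
  shows "pmf P (Suc (x + c)) * pmf P x \<le> pmf P (Suc x) * pmf P (x + c)"
proof (induction c)
  case (Suc c)
  show ?case
  proof (cases "pmf P (Suc (x + Suc c)) = 0 \<or> pmf P x = 0")
    case False
    have pos: "0 < pmf P (x + c)"
      by (rule log_concave_pmf_support[OF assms, of x "Suc (x + Suc c)"]) (use False in auto)
    have "pmf P (Suc (x + Suc c)) * pmf P (x + c) \<le> (pmf P (Suc (x + c)))\<^sup>2"
      using assms[unfolded log_concave_pmf_def, THEN conjunct2, rule_format, of "Suc (x + c)"] by simp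
    then have "pmf P (Suc (x + Suc c)) * pmf P (x + c) * pmf P x
        \<le> (pmf P (Suc (x + c)))\<^sup>2 * pmf P x"
      by (rule mult_right_mono) simp
    also have "\<dots> \<le> pmf P (Suc (x + c)) * (pmf P (Suc x) * pmf P (x + c))"
      using mult_left_mono[OF Suc.IH, of "pmf P (Suc (x + c))"]
      by (simp add: power2_eq_square mult_ac)
    finally have "pmf P (x + c) * (pmf P (Suc (x + Suc c)) * pmf P x)
        \<le> pmf P (x + c) * (pmf P (Suc x) * pmf P (x + Suc c))"
      by (simp add: mult_ac)
    then show ?thesis
      using pos by (simp only: mult_le_cancel_left_pos)
  qed auto
qed simp

text \<open>Telescopes the one-step inequality, taken at \<open>a + b\<close>, and cancels the two
  intermediate masses.\<close>

lemma log_concave_pmf_four_point: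
  assumes "log_concave_pmf P"
  shows "pmf P (a + b + c) * pmf P a \<le> pmf P (a + b) * pmf P (a + c)"
proof (induction b)
  case (Suc b)
  show ?case
  proof (cases "pmf P (a + Suc b + c) = 0 \<or> pmf P a = 0")
    case False
    have pos: "0 < pmf P (a + b)" "0 < pmf P (a + b + c)"
      by (rule log_concave_pmf_support[OF assms, of a "a + Suc b + c"]; use False in auto)+
    have "(pmf P (Suc (a + b + c)) * pmf P (a + b)) * (pmf P (a + b + c) * pmf P a)
        \<le> (pmf P (Suc (a + b)) * pmf P (a + b + c)) * (pmf P (a + b) * pmf P (a + c))"
      by (intro mult_mono log_concave_pmf_four_point_Suc assms Suc.IH) simp_all
    then have "(pmf P (a + b) * pmf P (a + b + c)) * (pmf P (a + Suc b + c) * pmf P a)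
        \<le> (pmf P (a + b) * pmf P (a + b + c)) * (pmf P (a + Suc b) * pmf P (a + c))"
      by (simp add: mult_ac)
    then show ?thesis
      using pos by (simp only: mult_le_cancel_left_pos mult_pos_pos)
  qed auto
qed simp

text \<open>Take \<open>- ln\<close> of the four-point inequality; if an outer mass vanishes, the
  right side is infinite. Arbitrary increments \<open>b\<close> and \<open>c\<close> are needed
  because they will be values of the random summands.\<close>

lemma self_information_convex:
  assumes "log_concave_pmf P"
  shows "self_information P (a + b) + self_information P (a + c)
    \<le> self_information P (a + b + c) + self_information P a"
proof (cases "pmf P (a + b + c) = 0 \<or> pmf P a = 0")
  case True
  then show ?thesis
    by (auto simp: self_information_def)
next
  case False
  have pos: "0 < pmf P (a + b)" "0 < pmf P (a + c)" "0 < pmf P (a + b + c)" "0 < pmf P a"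
    by (rule log_concave_pmf_support[OF assms, of a "a + b + c"]; use False in auto)+
  have ln_nonpos: "ln (pmf P x) \<le> 0" if "0 < pmf P x" for x
    using that by (simp add: pmf_le_1)
  have "ln (pmf P (a + b + c) * pmf P a) \<le> ln (pmf P (a + b) * pmf P (a + c))"
    using log_concave_pmf_four_point[OF assms, of a b c] pos by simp
  then have "ln (pmf P (a + b + c)) + ln (pmf P a) \<le> ln (pmf P (a + b)) + ln (pmf P (a + c))"
    using pos by (simp add: ln_mult)
  then show ?thesis
    using pos ln_nonpos[OF pos(1)] ln_nonpos[OF pos(2)] ln_nonpos[OF pos(3)] ln_nonpos[OF pos(4)]
    by (simp add: self_information_def ennreal_leI del: ln_le_zero_iff flip: ennreal_plus)
qed

section \<open>Convexity in the number of summands\<close>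

lemma nn_integral_conv_power_Suc:
  "(\<integral>\<^sup>+x. f x \<partial>measure_pmf (conv_power Q (Suc y)))
    = (\<integral>\<^sup>+a. \<integral>\<^sup>+s. f (a + s) \<partial>measure_pmf (conv_power Q y) \<partial>measure_pmf Q)"
  by (simp add: nn_integral_pair_pmf' case_prod_beta)

text \<open>Realise all the sums from one sum \<open>s\<close> of \<open>y\<close> terms and two
  further independent terms \<open>a\<close>, \<open>b\<close>. Both \<open>s + a\<close> and
  \<open>s + b\<close> have the law of \<open>y + 1\<close> terms, so the pointwise inequality can
  be integrated.\<close>

lemma nn_integral_conv_power_convex:
  fixes f :: "nat \<Rightarrow> ennreal" and Q :: "nat pmf"
  assumes "\<And>a b c. f (a + b) + f (a + c) \<le> f (a + b + c) + f a"
  defines "\<phi> \<equiv> (\<lambda>y. \<integral>\<^sup>+x. f x \<partial>measure_pmf (conv_power Q y))"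
  shows "2 * \<phi> (Suc y) \<le> \<phi> (Suc (Suc y)) + \<phi> y"
proof -
  have const: "(\<integral>\<^sup>+a. u \<partial>measure_pmf Q) = u" for u
    by simp
  let ?E = "\<lambda>h. \<integral>\<^sup>+a. \<integral>\<^sup>+b. \<integral>\<^sup>+s. h a b s \<partial>measure_pmf (conv_power Q y) \<partial>measure_pmf Q \<partial>measure_pmf Q"
  have add: "?E (\<lambda>a b s. g a b s + h a b s) = ?E g + ?E h" for g h :: "nat \<Rightarrow> nat \<Rightarrow> nat \<Rightarrow> ennreal"
    by (simp add: nn_integral_add)
  have "2 * \<phi> (Suc y) = ?E (\<lambda>a b s. f (s + a)) + ?E (\<lambda>a b s. f (s + b))"
    unfolding \<phi>_def nn_integral_conv_power_Suc const by (simp add: mult_2 add.commute)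
  also have "\<dots> = ?E (\<lambda>a b s. f (s + a) + f (s + b))"
    by (rule add[symmetric])
  also have "\<dots> \<le> ?E (\<lambda>a b s. f (s + a + b) + f s)"
    by (intro nn_integral_mono assms(1))
  also have "\<dots> = \<phi> (Suc (Suc y)) + \<phi> y"
    unfolding add \<phi>_def nn_integral_conv_power_Suc const by (simp add: add_ac)
  finally show ?thesis .
qed

section \<open>Bernoulli sums and smoothing of two parameters\<close>

text \<open>A general index set lets single indices be split off.\<close>

definition bernoulli_sum_on :: "nat set \<Rightarrow> (nat \<Rightarrow> real) \<Rightarrow> nat pmf" where
  "bernoulli_sum_on A p =
     map_pmf (\<lambda>B. \<Sum>i\<in>A. of_bool (B i)) (Pi_pmf A False (\<lambda>i. bernoulli_pmf (p i)))"

lemma bernoulli_sum_on_cong: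
  "(\<And>i. i \<in> A \<Longrightarrow> p i = q i) \<Longrightarrow> bernoulli_sum_on A p = bernoulli_sum_on A q"
  unfolding bernoulli_sum_on_def by (intro arg_cong2[of _ _ _ _ map_pmf] Pi_pmf_cong) auto

lemma bernoulli_sum_on_insert:
  assumes "finite A" "i \<notin> A"
  shows "bernoulli_sum_on (insert i A) p =
    map_pmf (\<lambda>(b, s). of_bool b + s) (pair_pmf (bernoulli_pmf (p i)) (bernoulli_sum_on A p))"
proof -
  have "(\<Sum>j\<in>insert i A. of_bool ((B(i := b)) j)) = of_bool b + (\<Sum>j\<in>A. of_bool (B j) :: nat)"
    for b B
    unfolding sum.insert[OF assms] by (intro arg_cong2[of _ _ _ _ "(+)"] sum.cong) (use assms in auto)
  then show ?thesis
    unfolding bernoulli_sum_on_def Pi_pmf_insert[OF assms]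
    by (simp add: map_pmf_comp case_prod_beta pair_map_pmf2 del: sum.insert fun_upd_apply)
qed

lemma nn_integral_bernoulli_sum_on_insert:
  assumes "finite A" "i \<notin> A" "p i \<in> {0..1}"
  shows "(\<integral>\<^sup>+y. f y \<partial>measure_pmf (bernoulli_sum_on (insert i A) p)) =
    (\<integral>\<^sup>+y. ennreal (p i) * f (Suc y) + ennreal (1 - p i) * f y \<partial>measure_pmf (bernoulli_sum_on A p))"
  using assms
  by (simp add: bernoulli_sum_on_insert nn_integral_pair_pmf' nn_integral_add nn_integral_cmult
      mult.commute[of _ "ennreal _"])

text \<open>Here \<open>u\<close>, \<open>v\<close>, \<open>w\<close> are the values at 0, 1, 2
  successes. With the sum of the parameters fixed, raising their product by \<open>e\<close> moves
  mass \<open>2 * e\<close> from \<open>v\<close> in equal shares to \<open>u\<close> and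
  \<open>w\<close>.\<close>

lemma two_bernoulli_mono:
  fixes u v w :: ennreal and a b c d :: real
  assumes "2 * v \<le> w + u" "a + b = c + d" "a * b \<le> c * d"
    and "a \<in> {0..1}" "b \<in> {0..1}" "c \<in> {0..1}" "d \<in> {0..1}"
  shows "ennreal a * (ennreal b * w + ennreal (1 - b) * v) + ennreal (1 - a) * (ennreal b * v + ennreal (1 - b) * u)
    \<le> ennreal c * (ennreal d * w + ennreal (1 - d) * v) + ennreal (1 - c) * (ennreal d * v + ennreal (1 - d) * u)"
proof -
  define e where "e = c * d - a * b"
  define m where "m = c * (1 - d) + (1 - c) * d"
  have e: "0 \<le> e" and m: "0 \<le> m"
    using assms by (simp_all add: e_def m_def)
  have expand: "ennreal p * (ennreal q * w + ennreal (1 - q) * v) + ennreal (1 - p) * (ennreal q * v + ennreal (1 - q) * u)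
      = ennreal (p * q) * w + ennreal (p * (1 - q) + (1 - p) * q) * v + ennreal ((1 - p) * (1 - q)) * u"
    if "p \<in> {0..1}" "q \<in> {0..1}" for p q
    using that by (simp add: ennreal_mult distrib_left distrib_right mult.assoc add_ac)
  \<comment> \<open>The weights for \<open>a\<close>, \<open>b\<close> and for \<open>c\<close>,
    \<open>d\<close> are compared over the reals, so that no subtraction of \<open>ennreal\<close>
    values occurs.\<close>
  have ab: "a * (1 - b) + (1 - a) * b = m + 2 * e" "c * d = a * b + e"
    "(1 - c) * (1 - d) = (1 - a) * (1 - b) + e"
    using assms(2) by (simp_all add: m_def e_def algebra_simps)
  have "ennreal (a * b) * w + ennreal (m + 2 * e) * v + ennreal ((1 - a) * (1 - b)) * u
      = ennreal (a * b) * w + ennreal m * v + ennreal ((1 - a) * (1 - b)) * u + ennreal e * (2 * v)"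
    using e m by (simp add: ennreal_mult' distrib_left distrib_right mult_ac add_ac)
  also have "\<dots> \<le> ennreal (a * b) * w + ennreal m * v + ennreal ((1 - a) * (1 - b)) * u
      + ennreal e * (w + u)"
    by (intro add_left_mono mult_left_mono assms(1)) simp
  also have "\<dots> = ennreal (a * b + e) * w + ennreal m * v + ennreal ((1 - a) * (1 - b) + e) * u"
    using e assms(4,5) by (simp add: distrib_left distrib_right add_ac)
  finally show ?thesis
    using assms(4-) by (simp add: expand ab(1) ab(2,3) m_def[symmetric])
qed

text \<open>Condition on the sum over the remaining indices \<open>C\<close>, whose law is
  unchanged, and apply the two-variable comparison pointwise.\<close>

lemma nn_integral_bernoulli_sum_on_smoothing:
  fixes \<phi> :: "nat \<Rightarrow> ennreal"
  assumes "finite A" "i \<in> A" "j \<in> A" "i \<noteq> j"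
    and convex: "\<And>y. 2 * \<phi> (Suc y) \<le> \<phi> (Suc (Suc y)) + \<phi> y"
    and p: "p i \<in> {0..1}" "p j \<in> {0..1}" and cd: "c \<in> {0..1}" "d \<in> {0..1}"
    and "p i + p j = c + d" "p i * p j \<le> c * d"
  shows "(\<integral>\<^sup>+y. \<phi> y \<partial>measure_pmf (bernoulli_sum_on A p))
    \<le> (\<integral>\<^sup>+y. \<phi> y \<partial>measure_pmf (bernoulli_sum_on A (p(i := c, j := d))))"
proof -
  define C where "C = A - {i, j}"
  have C: "A = insert i (insert j C)" "finite C" "j \<notin> C" "i \<notin> insert j C"
    using assms(1-4) by (auto simp: C_def)
  have expand: "(\<integral>\<^sup>+y. \<phi> y \<partial>measure_pmf (bernoulli_sum_on A q)) =
      (\<integral>\<^sup>+y. ennreal (q j) * (ennreal (q i) * \<phi> (Suc (Suc y)) + ennreal (1 - q i) * \<phi> (Suc y))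
           + ennreal (1 - q j) * (ennreal (q i) * \<phi> (Suc y) + ennreal (1 - q i) * \<phi> y)
        \<partial>measure_pmf (bernoulli_sum_on C q))" if "q i \<in> {0..1}" "q j \<in> {0..1}" for q
    using that C by (simp add: nn_integral_bernoulli_sum_on_insert)
  have "bernoulli_sum_on C (p(i := c, j := d)) = bernoulli_sum_on C p"
    by (rule bernoulli_sum_on_cong) (use C in auto)
  moreover have "2 * \<phi> (Suc y) \<le> \<phi> (Suc (Suc y)) + \<phi> y" for y
    by (rule convex)
  ultimately show ?thesis
    using assms by (simp add: expand, intro nn_integral_mono two_bernoulli_mono)
       (simp_all add: add.commute mult.commute)
qed

section \<open>Equal parameters maximise convex expectations\<close>

text \<open>Induction on the number of parameters different from the mean \<open>m\<close>: each
  smoothing sets at least one more of them to \<open>m\<close>.\<close>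

theorem hoeffding_convex_bernoulli_sum:
  fixes \<phi> :: "nat \<Rightarrow> ennreal"
  assumes "finite A" "p \<in> A \<rightarrow> {0..1}" "m \<in> {0..1}" "(\<Sum>i\<in>A. p i) = real (card A) * m"
    and convex: "\<And>y. 2 * \<phi> (Suc y) \<le> \<phi> (Suc (Suc y)) + \<phi> y"
  shows "(\<integral>\<^sup>+y. \<phi> y \<partial>measure_pmf (bernoulli_sum_on A p))
    \<le> (\<integral>\<^sup>+y. \<phi> y \<partial>measure_pmf (bernoulli_sum_on A (\<lambda>_. m)))"
  using assms(2,4)
proof (induction "card {i \<in> A. p i \<noteq> m}" arbitrary: p rule: less_induct)
  case less
  show ?case
  proof (cases "\<forall>i\<in>A. p i = m")
    case True
    then show ?thesis
      by (simp cong: bernoulli_sum_on_cong)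
  next
    case False
    then obtain k where k: "k \<in> A" "p k \<noteq> m" by blast
    have sum_zero: "(\<Sum>i\<in>A. p i - m) = 0"
      by (simp add: sum_subtractf less.prems)
    \<comment> \<open>The deviations from \<open>m\<close> sum to zero and are not all zero, so both
      signs occur.\<close>
    have "\<exists>i\<in>A. p i < m"
    proof (rule ccontr)
      assume "\<not> (\<exists>i\<in>A. p i < m)"
      then have "\<forall>i\<in>A. p i - m = 0"
        using sum_zero \<open>finite A\<close> by (subst (asm) sum_nonneg_eq_0_iff) (auto simp: not_less)
      then show False using k by simp
    qed
    then obtain i where i: "i \<in> A" "p i < m" by blast
    have "\<exists>j\<in>A. m < p j"
    proof (rule ccontr)
      assume "\<not> (\<exists>j\<in>A. m < p j)"
      then have "\<forall>i\<in>A. p i - m = 0"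
        using sum_zero \<open>finite A\<close> sum_nonneg_eq_0_iff[of A "\<lambda>i. m - p i"]
        by (auto simp: not_less sum_subtractf)
      then show False using k by simp
    qed
    then obtain j where j: "j \<in> A" "m < p j" by blast
    have ij: "i \<noteq> j" using i j by auto
    define d where "d = p i + p j - m"
    define q where "q = p(i := m, j := d)"
    have bounds: "p i \<in> {0..1}" "p j \<in> {0..1}"
      using less.prems(1) i j by auto
    \<comment> \<open>Since \<open>p i < m < p j\<close>, the value \<open>d\<close> lies strictly
      between \<open>p i\<close> and \<open>p j\<close>.\<close>
    then have d: "d \<in> {0..1}"
      using i j assms(3) by (auto simp: d_def)
    \<comment> \<open>This product equals \<open>m * d - p i * p j\<close>.\<close>
    have "0 \<le> (m - p i) * (p j - m)"
      using i j by simp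
    then have prod: "p i * p j \<le> m * d"
      by (simp add: d_def algebra_simps)
    have "(\<integral>\<^sup>+y. \<phi> y \<partial>measure_pmf (bernoulli_sum_on A p))
        \<le> (\<integral>\<^sup>+y. \<phi> y \<partial>measure_pmf (bernoulli_sum_on A q))"
      unfolding q_def using bounds d prod i j ij assms(1,3)
      by (intro nn_integral_bernoulli_sum_on_smoothing convex) (auto simp: d_def)
    also have "\<dots> \<le> (\<integral>\<^sup>+y. \<phi> y \<partial>measure_pmf (bernoulli_sum_on A (\<lambda>_. m)))"
    proof (rule less.hyps)
      show "card {k \<in> A. q k \<noteq> m} < card {k \<in> A. p k \<noteq> m}"
      proof (rule psubset_card_mono)
        \<comment> \<open>Index \<open>i\<close> leaves the set, and \<open>j\<close> already
          belonged to it.\<close>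
        show "{k \<in> A. q k \<noteq> m} \<subset> {k \<in> A. p k \<noteq> m}"
          using i j ij by (auto simp: q_def split: if_splits)
      qed (use assms(1) in simp)
      show "q \<in> A \<rightarrow> {0..1}"
        using less.prems(1) assms(3) d by (auto simp: q_def)
      have split: "(\<Sum>k\<in>A. r k) = r i + r j + (\<Sum>k\<in>A - {i, j}. r k)" for r :: "nat \<Rightarrow> real"
        using i j ij assms(1) sum.subset_diff[of "{i, j}" A r] by simp
      have "(\<Sum>k\<in>A - {i, j}. q k) = (\<Sum>k\<in>A - {i, j}. p k)"
        by (rule sum.cong) (auto simp: q_def)
      then have "(\<Sum>k\<in>A. q k) = (\<Sum>k\<in>A. p k)"
        using ij unfolding split by (simp add: q_def d_def)
      then show "(\<Sum>k\<in>A. q k) = real (card A) * m"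
        using less.prems(2) by simp
    qed
    finally show ?thesis .
  qed
qed

theorem theorem1p4:
  fixes n :: nat and l :: real and Q :: "nat pmf"
  assumes "n \<ge> 1"
    and "0 < l" and "l \<le> real n"
    and "pmf Q 0 = 0"
    and "log_concave_pmf Q"
    and "log_concave_pmf (compound_binomial n (l / real n) Q)"
    and "finite (set_pmf Q) \<or>
         (\<exists>\<rho> \<beta> :: real. \<exists>N\<^sub>0 :: nat. \<rho> > 0 \<and> \<beta> > 0 \<and> N\<^sub>0 \<ge> 1 \<and>
            (\<forall>x\<ge>N\<^sub>0. pmf Q x \<ge> \<rho> powr (real x powr \<beta>)))"
  shows "pmf_entropy (compound_binomial n (l / real n) Q)
           \<in> {pmf_entropy (compound Q (bernoulli_sum n p)) | p. p \<in> param_set n l} \<and>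
         (\<forall>h \<in> {pmf_entropy (compound Q (bernoulli_sum n p)) | p. p \<in> param_set n l}.
            h \<le> pmf_entropy (compound_binomial n (l / real n) Q))"
proof -
  define m where "m = l / real n"
  define G where "G = compound_binomial n m Q"
  define \<phi> where "\<phi> y = (\<integral>\<^sup>+x. self_information G x \<partial>measure_pmf (conv_power Q y))" for y
  have m: "m \<in> {0..1}" "real n * m = l"
    using assms(1-3) by (simp_all add: m_def)
  have bern: "bernoulli_sum n p = bernoulli_sum_on {1..n} p" for p
    by (simp add: bernoulli_sum_def bernoulli_sum_on_def)
  have G: "G = compound Q (bernoulli_sum_on {1..n} (\<lambda>_. m))"
    unfolding G_def compound_binomial_def bern
    by (intro arg_cong[of _ _ "compound Q"] bernoulli_sum_on_cong) simp
  \<comment> \<open>Conditioning on the number of summands.\<close>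
  have expect: "(\<integral>\<^sup>+x. self_information G x \<partial>measure_pmf (compound Q P)) = (\<integral>\<^sup>+y. \<phi> y \<partial>measure_pmf P)" for P
    by (simp add: compound_def \<phi>_def)
  have convex: "2 * \<phi> (Suc y) \<le> \<phi> (Suc (Suc y)) + \<phi> y" for y
    unfolding \<phi>_def
    using assms(6) by (intro nn_integral_conv_power_convex self_information_convex) (simp add: G_def m_def)
  have le: "pmf_entropy (compound Q (bernoulli_sum n p)) \<le> pmf_entropy G"
    if "p \<in> param_set n l" for p
  proof -
    have "pmf_entropy (compound Q (bernoulli_sum n p)) \<le> (\<integral>\<^sup>+y. \<phi> y \<partial>measure_pmf (bernoulli_sum_on {1..n} p))"
      using gibbs_inequality[of _ G] unfolding bern expect[symmetric] .
    also have "\<dots> \<le> (\<integral>\<^sup>+y. \<phi> y \<partial>measure_pmf (bernoulli_sum_on {1..n} (\<lambda>_. m)))"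
      using that m by (intro hoeffding_convex_bernoulli_sum convex) (auto simp: param_set_def PiE_def)
    \<comment> \<open>At equal parameters the compound law is \<open>G\<close>, so the cross-entropy
      is the entropy of \<open>G\<close> itself.\<close>
    also have "\<dots> = pmf_entropy G"
      by (simp only: expect[symmetric] G[symmetric] pmf_entropy_eq_nn_integral)
    finally show ?thesis .
  qed
  \<comment> \<open>The maximum is attained; the restriction to \<open>{1..n}\<close> makes the
    constant vector extensional.\<close>
  have "(\<lambda>i\<in>{1..n}. m) \<in> param_set n l"
    using m by (auto simp: param_set_def)
  then show ?thesis
    using le unfolding G_def m_def compound_binomial_def by blast
qed

end
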